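(* Let $n,N\in\mathbb{N}$, $N\ge 2$, and let $f_1,\dots,f_N\in\mathcal{A}(\mathbb{R}^n)$. Suppose that $f_1=\big(\bigoplus_{i=2}^N f_i\big)^c$, i.e. $$f_1(x_1)=\sup_{x_2,\dots,x_N\in\mathbb{R}^n}\Big(c(x_1,\dots,x_N)-\sum_{i=2}^N f_i(x_i)\Big)\quad\text{for all }x_1\in\mathbb{R}^n,$$ and that $f_1$ is essentially smooth. Let $$\Gamma=\Big\{(x_1,\dots,x_N)\in(\mathbb{R}^n)^N\ \Big|\ \sum_{i=1}^N f_i(x_i)=c(x_1,\dots,x_N)\Big\}.$$ Then all of the following assertions hold: (i) there exists $1\le i_0\le N$ such that $\Gamma_{i_0}$ is maximally monotone; (ii) there exists $1\le i_0\le N$ such that $\Gamma_{i_0}=\partial f_{i_0}$; (iii) $\Gamma_i=\partial f_i$ for each $1\le i\le N$; (iv) $\operatorname{Prox}_{f_1}+\cdots+\operatorname{Prox}_{f_N}=\mathrm{Id}$; (v) $e_{f_1^*}+\cdots+e_{f_N^*}=q$; (vi) $\Gamma+\Delta^\perp=(\mathbb{R}^n)^N$; (vii) $S(\Gamma)=\mathbb{R}^n$.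
   Context: $\mathcal{A}(\mathcal{H})$ denotes the set of proper, lower-semicontinuous, convex functions $\mathcal{H}\to\mathbb{R}\cup\{+\infty\}$ on a real Hilbert space $\mathcal{H}$ (here $\mathcal{H}=\mathbb{R}^n$ with the dot product). $c(x_1,\dots,x_N)=\sum_{1\le i<j\le N}\langle x_i,x_j\rangle$. A function $f\in\mathcal{A}(\mathbb{R}^n)$ is essentially smooth if, with $C=\operatorname{int}(\operatorname{dom} f)$, $\operatorname{dom} f=\{x: f(x)\in\mathbb{R}\}$: (a) $C\neq\emptyset$; (b) $f$ is differentiable throughout $C$; (c) $\lim_{i\to\infty}|\nabla f(x_i)|=+\infty$ whenever $x_1,x_2,\dots$ is a sequence in $C$ converging to a boundary point of $C$. For $1\le i_0\le N$, $\Gamma_{i_0}:\mathcal{H}\to 2^{\mathcal{H}}$ is the set-valued map $\Gamma_{i_0}(x_{i_0})=\{\sum_{i\ne i_0}x_i \mid (x_1,\dots,x_{i_0},\dots,x_N)\in\Gamma\}$. $\partial f$ is the convex subdifferential. $\operatorname{Prox}_f$ is the proximal mapping, $\operatorname{Prox}_f(x)=\operatorname{argmin}_y\,(f(y)+\tfrac12|x-y|^2)$. $\mathrm{Id}$ is the identity map. $q(x)=\tfrac12|x|^2$. $f^*(y)=\sup_x(\langle x,y\rangle-f(x))$ is the convex conjugate. $e_f(x)=\inf_y\big(f(y)+q(x-y)\big)$ is the Moreau envelope. $\Delta=\{(x,\dots,x)\mid x\in\mathcal{H}\}\subseteq\mathcal{H}^N$ is the diagonal subspace and $\Delta^\perp$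 its orthogonal complement. $S(\Gamma)=\{\sum_{i=1}^N x_i\mid(x_1,\dots,x_N)\in\Gamma\}$. *)

theory Defs
  imports "HOL-Analysis.Analysis"
begin

section \<open>Convex functions with values in the extended reals\<close>

definition dom_fun :: "('a \<Rightarrow> ereal) \<Rightarrow> 'a set" where
  "dom_fun f = {x. \<bar>f x\<bar> \<noteq> \<infinity>}"

definition proper_fun :: "('a \<Rightarrow> ereal) \<Rightarrow> bool" where
  "proper_fun f \<longleftrightarrow> (\<forall>x. f x \<noteq> -\<infinity>) \<and> (\<exists>x. f x \<noteq> \<infinity>)"

definition lsc_fun :: "('a::topological_space \<Rightarrow> ereal) \<Rightarrow> bool" where
  "lsc_fun f \<longleftrightarrow> (\<forall>x. f x \<le> Liminf (nhds x) f)"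

text \<open>Since \<open>0 * \<infinity> = 0\<close> in \<^typ>\<open>ereal\<close>, the cases \<open>u = 0\<close> and \<open>v = 0\<close> impose nothing.
  The predicate is only meant for functions that avoid \<open>-\<infinity>\<close>.\<close>

definition convex_fun :: "('a::real_vector \<Rightarrow> ereal) \<Rightarrow> bool" where
  "convex_fun f \<longleftrightarrow>
     (\<forall>x y. \<forall>u\<ge>0. \<forall>v\<ge>0. u + v = 1 \<longrightarrow>
        f (u *\<^sub>R x + v *\<^sub>R y) \<le> ereal u * f x + ereal v * f y)"

definition proper_lsc_convex :: "('a::real_normed_vector \<Rightarrow> ereal) set" where
  "proper_lsc_convex = {f. proper_fun f \<and> lsc_fun f \<and> convex_fun f}"

text \<open>Differentiability and the gradient are only considered at interior points of the domain,
  where \<open>f\<close> agrees locally with its real-valued part.\<close>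

definition gradient :: "('a::real_inner \<Rightarrow> ereal) \<Rightarrow> 'a \<Rightarrow> 'a" where
  "gradient f x = (THE D. GDERIV (\<lambda>y. real_of_ereal (f y)) x :> D)"

definition essentially_smooth :: "('a::real_inner \<Rightarrow> ereal) \<Rightarrow> bool" where
  "essentially_smooth f \<longleftrightarrow>
     (let C = interior (dom_fun f) in
        C \<noteq> {} \<and>
        (\<forall>x\<in>C. (\<lambda>y. real_of_ereal (f y)) differentiable (at x)) \<and>
        (\<forall>X x. (\<forall>i::nat. X i \<in> C) \<and> x \<in> frontier C \<and> X \<longlonglongrightarrow> x \<longrightarrow>
           filterlim (\<lambda>i. norm (gradient f (X i))) at_top sequentially))"

definition subdifferential :: "('a::real_inner \<Rightarrow> ereal) \<Rightarrow> 'a \<Rightarrow> 'a set" where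
  "subdifferential f x = {u. \<forall>y. f x + ereal (inner u (y - x)) \<le> f y}"

definition conjugate :: "('a::real_inner \<Rightarrow> ereal) \<Rightarrow> 'a \<Rightarrow> ereal" where
  "conjugate f y = (SUP x. ereal (inner x y) - f x)"

definition half_sq :: "'a::real_inner \<Rightarrow> real" where
  "half_sq x = (norm x)\<^sup>2 / 2"

definition moreau_envelope :: "('a::real_inner \<Rightarrow> ereal) \<Rightarrow> 'a \<Rightarrow> ereal" where
  "moreau_envelope f x = (INF y. f y + ereal (half_sq (x - y)))"

text \<open>For proper, lower semicontinuous, convex \<open>f\<close> on a Hilbert space the minimizer exists and is
  unique, so the choice made by \<^const>\<open>arg_min\<close> is immaterial there.\<close>

definition Prox :: "('a::real_inner \<Rightarrow> ereal) \<Rightarrow> 'a \<Rightarrow> 'a" where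
  "Prox f x = (ARG_MIN (\<lambda>y. f y + ereal (half_sq (x - y))) y. True)"

section \<open>Monotone set-valued maps\<close>

definition monotone_map :: "('a::real_inner \<Rightarrow> 'a set) \<Rightarrow> bool" where
  "monotone_map T \<longleftrightarrow> (\<forall>x y. \<forall>u\<in>T x. \<forall>v\<in>T y. 0 \<le> inner (x - y) (u - v))"

definition maximally_monotone :: "('a::real_inner \<Rightarrow> 'a set) \<Rightarrow> bool" where
  "maximally_monotone T \<longleftrightarrow>
     monotone_map T \<and> (\<forall>S. monotone_map S \<and> (\<forall>x. T x \<subseteq> S x) \<longrightarrow> S = T)"

section \<open>The multi-marginal setting\<close>

text \<open>The indices \<open>1, \<dots>, N\<close> are the elements of a finite linearly ordered type \<open>'k\<close>
  with \<open>N = CARD('k)\<close>; the index \<open>1\<close> is its least element. An \<open>N\<close>-tuple of points of \<open>'a\<close>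
  is an element of \<open>'a ^ 'k\<close>, whose inner product is that of the product space.\<close>

definition first_index :: "'k::{finite,linorder}" where
  "first_index = Min UNIV"

definition cost :: "('a::real_inner) ^ 'k::{finite,linorder} \<Rightarrow> real" where
  "cost x = (\<Sum>(i, j) | i < j. inner (x $ i) (x $ j))"

definition contact_set ::
    "('k::{finite,linorder} \<Rightarrow> 'a::real_inner \<Rightarrow> ereal) \<Rightarrow> ('a ^ 'k::{finite,linorder}) set" where
  "contact_set f = {x. (\<Sum>i\<in>UNIV. f i (x $ i)) = ereal (cost x)}"

definition marginal_map ::
    "(('a::real_inner) ^ 'k) set \<Rightarrow> 'k::finite \<Rightarrow> 'a \<Rightarrow> 'a set" where
  "marginal_map G i y = {(\<Sum>j\<in>UNIV - {i}. x $ j) | x. x \<in> G \<and> x $ i = y}"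

definition diagonal :: "('a ^ 'k::finite) set" where
  "diagonal = range (\<lambda>y. \<chi> i. y)"

definition sum_set :: "(('a::real_inner) ^ 'k::finite) set \<Rightarrow> 'a set" where
  "sum_set G = {(\<Sum>i\<in>UNIV. x $ i) | x. x \<in> G}"

end

theory Submission
  imports Defs
begin

text \<open>Write \<open>q\<close> for \<^const>\<open>half_sq\<close>. The hypothesis on the first function says that
  \<open>cost x \<le> (\<Sum>i\<in>UNIV. f i (x $ i))\<close> for all \<open>x\<close>, and that \<open>f first_index\<close> is the least function with this property
  for the given others. The contact set \<open>\<Gamma>\<close> is where equality holds. Fixing all coordinates
  of a point of \<open>\<Gamma>\<close> but the \<open>i\<close>-th shows that \<open>z - x $ i\<close>, with \<open>z\<close> the sum of the coordinates
  of \<open>x\<close>, is a subgradient of \<open>f i\<close> at \<open>x $ i\<close> (\<open>contact_subgradient\<close>).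

  Everything follows from the assertion that every \<open>z\<close> is the coordinate sum of a point \<open>x\<close> of \<open>\<Gamma>\<close>.
  Indeed, \<open>x $ i\<close> is then the proximal point \<open>Prox (f i) z\<close>, which gives the
  decomposition of the identity; since proximal points are unique, every subgradient of \<open>f i\<close>
  arises from \<open>\<Gamma>\<close>; the operators \<open>Id + \<partial>(f i)\<close> are onto, so the \<open>\<partial>(f i)\<close> are maximally monotone; the envelope of the
  conjugate of \<open>f i\<close> at \<open>z\<close> equals \<open>inner z (x $ i) - q (x $ i) - f i (x $ i)\<close>, and these values add up to
  \<open>q z\<close> because \<open>cost x = q z - (\<Sum>i\<in>UNIV. q (x $ i))\<close>; and any \<open>w\<close> differs from the point of \<open>\<Gamma>\<close> with the
  same coordinate sum by a vector orthogonal to the diagonal.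

  For the assertion itself (\<open>essentially_smooth_sum_set_contact\<close>), let \<open>p\<close> be the proximal point of \<open>z\<close>
  for \<open>f first_index\<close>, so that \<open>z - p\<close> is a subgradient there. By essential smoothness \<open>p\<close> is interior to the domain
  (\<open>essentially_smooth_subgradient_interior\<close>) and the gradient is the only subgradient at \<open>p\<close>. Near
  \<open>p\<close> the function is bounded above, which makes the supremum defining \<open>f first_index p\<close> coercive
  and hence attained (\<open>contact_attained\<close>): some \<open>x\<close> in \<open>\<Gamma>\<close> has first coordinate \<open>p\<close>. The sum of its other
  coordinates is a subgradient at \<open>p\<close>, hence equals \<open>z - p\<close>.\<close>

section \<open>Preliminaries\<close>

lemma half_sq_inner: "half_sq x = inner x x / 2"
  by (simp add: half_sq_def power2_norm_eq_inner)

lemma half_sq_diff: "half_sq (x - y) = half_sq x - inner x y + half_sq y"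
  by (simp add: half_sq_inner inner_diff inner_commute field_simps)

lemma half_sq_nonneg: "0 \<le> half_sq x"
  by (simp add: half_sq_def)

lemma inner_sgn_self: "inner x (sgn x) = norm x"
  by (cases "x = 0")
    (simp_all add: sgn_div_norm power2_norm_eq_inner[symmetric] power2_eq_square field_simps)

lemma proper_lsc_convexD:
  assumes "f \<in> proper_lsc_convex"
  shows "proper_fun f" "lsc_fun f" "convex_fun f"
  using assms by (auto simp: proper_lsc_convex_def)

section \<open>Lower semicontinuous functions\<close>

lemma lsc_fun_iff: "lsc_fun f \<longleftrightarrow> (\<forall>x. \<forall>a<f x. \<forall>\<^sub>F y in nhds x. a < f y)"
  by (simp add: lsc_fun_def le_Liminf_iff)

lemma lsc_fun_ereal:
  assumes "\<And>x. isCont f x"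
  shows "lsc_fun (\<lambda>x. ereal (f x))"
  unfolding lsc_fun_iff
proof (intro allI impI)
  fix x a assume "a < ereal (f x)"
  moreover have "((\<lambda>x. ereal (f x)) \<longlongrightarrow> ereal (f x)) (nhds x)"
    using assms[of x] by (simp add: isCont_def tendsto_at_iff_tendsto_nhds)
  ultimately show "\<forall>\<^sub>F y in nhds x. a < ereal (f y)"
    by (rule order_tendstoD(1)[rotated])
qed

lemma lsc_fun_compose:
  assumes "lsc_fun f" "\<And>x. isCont g x"
  shows "lsc_fun (\<lambda>x. f (g x))"
  unfolding lsc_fun_iff
proof (intro allI impI)
  fix x a assume "a < f (g x)"
  then have "\<forall>\<^sub>F y in nhds (g x). a < f y"
    using assms(1) by (simp add: lsc_fun_iff)
  moreover have "filterlim g (nhds (g x)) (nhds x)"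
    using assms(2)[of x] by (simp add: isCont_def tendsto_at_iff_tendsto_nhds)
  ultimately show "\<forall>\<^sub>F y in nhds x. a < f (g y)"
    by (rule eventually_compose_filterlim)
qed

lemma ereal_less_add_split:
  fixes a F G :: ereal
  assumes "a < F + G" "F \<noteq> -\<infinity>" "G \<noteq> -\<infinity>"
  obtains b c where "b < F" "c < G" "a \<le> b + c"
proof (cases a)
  case (real r)
  show ?thesis
  proof (cases F)
    case F: (real s)
    show ?thesis
    proof (cases G)
      case G: (real t)
      show ?thesis
        by (rule that[of "ereal (s - (s + t - r) / 2)" "ereal (t - (s + t - r) / 2)"])
           (use assms real F G in \<open>auto simp: field_simps\<close>)
    next
      case PInf
      show ?thesis
        by (rule that[of "ereal (s - 1)" "ereal (r - s + 1)"]) (use real F PInf in auto)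
    qed (use assms in auto)
  next
    case F: PInf
    show ?thesis
    proof (cases G)
      case G: (real t)
      show ?thesis
        by (rule that[of "ereal (r - t + 1)" "ereal (t - 1)"]) (use real F G in auto)
    next
      case PInf
      show ?thesis
        by (rule that[of "ereal r" "0"]) (use real F PInf in auto)
    qed (use assms in auto)
  qed (use assms in auto)
next
  case PInf then show ?thesis using assms by simp
next
  case MInf
  show ?thesis by (rule that[of "-\<infinity>" "-\<infinity>"]) (use assms MInf in auto)
qed

lemma lsc_fun_add:
  assumes "lsc_fun f" "lsc_fun g" "\<And>x. f x \<noteq> -\<infinity>" "\<And>x. g x \<noteq> -\<infinity>"
  shows "lsc_fun (\<lambda>x. f x + g x)"
  unfolding lsc_fun_iff
proof (intro allI impI)
  fix x a assume "a < f x + g x"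
  then obtain b c where bc: "b < f x" "c < g x" "a \<le> b + c"
    using ereal_less_add_split assms(3,4) by metis
  have "\<forall>\<^sub>F y in nhds x. b < f y" "\<forall>\<^sub>F y in nhds x. c < g y"
    using bc assms(1,2) by (auto simp: lsc_fun_iff)
  then show "\<forall>\<^sub>F y in nhds x. a < f y + g y"
  proof eventually_elim
    case (elim y)
    then have "b + c < f y + g y"
      by (cases b; cases c; cases "f y"; cases "g y") auto
    with bc(3) show ?case by (rule le_less_trans)
  qed
qed

lemma sum_neq_MInfty:
  fixes f :: "'i \<Rightarrow> ereal"
  assumes "\<And>i. i \<in> I \<Longrightarrow> f i \<noteq> -\<infinity>"
  shows "(\<Sum>i\<in>I. f i) \<noteq> -\<infinity>"
  using assms by (induction I rule: infinite_finite_induct) auto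

lemma lsc_fun_sum:
  assumes "finite I" "\<And>i. i \<in> I \<Longrightarrow> lsc_fun (f i)" "\<And>i x. i \<in> I \<Longrightarrow> f i x \<noteq> -\<infinity>"
  shows "lsc_fun (\<lambda>x. \<Sum>i\<in>I. f i x)"
  using assms
proof (induction I rule: finite_induct)
  case empty
  show ?case by (simp add: lsc_fun_iff)
next
  case (insert i I)
  then show ?case by (auto intro!: lsc_fun_add sum_neq_MInfty)
qed

text \<open>Instead of compactness of the domain, a single bounded sublevel set suffices.\<close>

lemma lsc_fun_attains_min:
  fixes F :: "'a::heine_borel \<Rightarrow> ereal"
  assumes F: "lsc_fun F" and S: "closed S" "x0 \<in> S"
    and bdd: "bounded {x \<in> S. F x \<le> F x0}"
  obtains x where "x \<in> S" "\<And>y. y \<in> S \<Longrightarrow> F x \<le> F y"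
proof -
  let ?L = "{x \<in> S. F x \<le> F x0}"
  have "F ` ?L \<noteq> {}" using S by auto
  from Inf_as_limit[OF this] obtain u
    where u: "\<And>n. u n \<in> F ` ?L" "u \<longlonglongrightarrow> Inf (F ` ?L)" by blast
  then have "\<forall>n. \<exists>x. x \<in> ?L \<and> u n = F x" by blast
  then obtain X where X: "\<And>n. X n \<in> ?L" "\<And>n. u n = F (X n)" by metis
  have "bounded (range X)"
    by (rule bounded_subset[OF bdd]) (use X in auto)
  then obtain l r where r: "strict_mono r" "(X \<circ> r) \<longlonglongrightarrow> l"
    using bounded_imp_convergent_subsequence by blast
  have l: "l \<in> S"
    by (rule closed_sequentially[OF S(1) _ r(2)]) (use X in auto)
  have lim: "(\<lambda>n. F ((X \<circ> r) n)) \<longlonglongrightarrow> Inf (F ` ?L)"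
    using LIMSEQ_subseq_LIMSEQ[OF u(2) r(1)] X(2) by (simp add: o_def)
  have le: "F l \<le> Inf (F ` ?L)"
  proof (rule ccontr)
    assume "\<not> ?thesis"
    then have "Inf (F ` ?L) < F l" by (rule not_le_imp_less)
    then obtain a where a: "Inf (F ` ?L) < a" "a < F l"
      using dense by blast
    have "\<forall>\<^sub>F y in nhds l. a < F y" using F a by (simp add: lsc_fun_iff)
    then have 1: "\<forall>\<^sub>F n in sequentially. a < F ((X \<circ> r) n)"
      using r(2) by (rule eventually_compose_filterlim)
    have 2: "\<forall>\<^sub>F n in sequentially. F ((X \<circ> r) n) < a"
      using lim a(1) by (rule order_tendstoD(2))
    have "\<forall>\<^sub>F n in sequentially. False"
      using 1 2 by eventually_elim auto
    then show False by simp
  qed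
  show ?thesis
  proof (rule that[OF l])
    fix y assume "y \<in> S"
    show "F l \<le> F y"
    proof (cases "F y \<le> F x0")
      case True
      then have "Inf (F ` ?L) \<le> F y" using \<open>y \<in> S\<close> by (auto intro: INF_lower)
      with le show ?thesis by simp
    next
      case False
      have "Inf (F ` ?L) \<le> F x0" using S by (auto intro: INF_lower)
      with le False show ?thesis by simp
    qed
  qed
qed

section \<open>Subgradients and the proximal mapping\<close>

lemma subgradient_imp_finite:
  assumes "proper_fun f" "u \<in> subdifferential f x"
  shows "\<bar>f x\<bar> \<noteq> \<infinity>"
proof -
  obtain y where y: "f y \<noteq> \<infinity>" using assms by (auto simp: proper_fun_def)
  have "f x + ereal (inner u (y - x)) \<le> f y" using assms by (simp add: subdifferential_def)
  then show ?thesis using y assms(1) by (cases "f x") (auto simp: proper_fun_def)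
qed

lemma monotone_subdifferential:
  assumes "proper_fun f"
  shows "monotone_map (subdifferential f)"
  unfolding monotone_map_def
proof (intro allI ballI)
  fix x y u v assume u: "u \<in> subdifferential f x" and v: "v \<in> subdifferential f y"
  obtain a b where ab: "f x = ereal a" "f y = ereal b"
    using subgradient_imp_finite[OF assms] u v by (metis ereal_real)
  have "f x + ereal (inner u (y - x)) \<le> f y" "f y + ereal (inner v (x - y)) \<le> f x"
    using u v by (auto simp: subdifferential_def)
  then show "0 \<le> inner (x - y) (u - v)"
    by (simp add: ab inner_diff inner_commute)
qed

text \<open>The subgradient inequality makes \<open>y \<mapsto> f y + half_sq (z - y)\<close> exceed its value at \<open>p\<close> by at
  least \<open>half_sq (y - p)\<close>, so that \<open>p\<close> is its only minimizer.\<close>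

lemma Prox_eqI:
  assumes f: "proper_fun f" and u: "z - p \<in> subdifferential f p"
  shows "Prox f z = p"
proof -
  let ?G = "\<lambda>y. f y + ereal (half_sq (z - y))"
  obtain a where a: "f p = ereal a"
    using subgradient_imp_finite[OF f u] by (metis ereal_real)
  have G: "?G p + ereal (half_sq (y - p)) \<le> ?G y" for y
  proof -
    have "f p + ereal (inner (z - p) (y - p)) \<le> f y" using u by (simp add: subdifferential_def)
    moreover have "half_sq (z - p) + half_sq (y - p) = inner (z - p) (y - p) + half_sq (z - y)"
      by (simp add: half_sq_inner inner_diff inner_commute field_simps)
    ultimately show ?thesis
      using f by (cases "f y") (auto simp: a proper_fun_def)
  qed
  have "is_arg_min ?G (\<lambda>_. True) p"
    unfolding is_arg_min_def
  proof (intro conjI TrueI notI, elim exE conjE)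
    fix y assume "?G y < ?G p"
    with G[of y] half_sq_nonneg[of "y - p"] show False
      by (cases "f y") (auto simp: a)
  qed
  moreover have "y = p" if "is_arg_min ?G (\<lambda>_. True) y" for y
  proof -
    have "?G y \<le> ?G p" using that by (auto simp: is_arg_min_def not_less)
    with G[of y] have "half_sq (y - p) \<le> 0" by (cases "f y") (auto simp: a)
    then show ?thesis by (simp add: half_sq_def)
  qed
  ultimately show ?thesis unfolding Prox_def arg_min_def by (rule some_equality)
qed

text \<open>The operator \<open>Id + \<partial>f\<close> is onto. The point \<open>p\<close> is a minimizer of
  \<open>y \<mapsto> f y + half_sq (z - y)\<close>, which is coercive because \<open>f\<close> has an affine minorant; comparing
  \<open>p\<close> with points of the segment towards \<open>y\<close> and letting them tend to \<open>p\<close> gives the subgradient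
  inequality.\<close>

lemma subgradient_exists_resolvent:
  fixes f :: "'a::euclidean_space \<Rightarrow> ereal"
  assumes f: "f \<in> proper_lsc_convex" and minorant: "\<And>y. ereal (inner v y + c) \<le> f y"
  obtains p where "z - p \<in> subdifferential f p"
proof -
  note f = proper_lsc_convexD[OF f]
  let ?G = "\<lambda>y. f y + ereal (half_sq (z - y))"
  obtain x0 a where a: "f x0 = ereal a"
    using f(1) unfolding proper_fun_def by (metis ereal_cases)
  have lsc: "lsc_fun ?G"
    using f(1) by (intro lsc_fun_add f(2) lsc_fun_ereal)
      (auto simp: proper_fun_def half_sq_def intro!: continuous_intros)
  have "{y \<in> UNIV. ?G y \<le> ?G x0} \<subseteq>
      cball z (sqrt (4 * (a + half_sq (z - x0) - c - inner v z + inner v v)))"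
  proof safe
    fix y assume "?G y \<le> ?G x0"
    then have "inner v y + c + half_sq (z - y) \<le> a + half_sq (z - x0)"
      using minorant[of y] by (cases "f y") (auto simp: a)
    \<comment> \<open>Half of the quadratic term absorbs the linear one.\<close>
    moreover have "0 \<le> inner (v - (1/2) *\<^sub>R (z - y)) (v - (1/2) *\<^sub>R (z - y))" by simp
    then have "inner v (z - y) \<le> inner v v + inner (z - y) (z - y) / 4"
      unfolding inner_simps by (simp add: inner_commute field_simps)
    ultimately have "(norm (z - y))\<^sup>2 \<le> 4 * (a + half_sq (z - x0) - c - inner v z + inner v v)"
      unfolding power2_norm_eq_inner half_sq_inner[of "z - y"] by (simp add: inner_diff_right[of v])
    then show "y \<in> cball z (sqrt (4 * (a + half_sq (z - x0) - c - inner v z + inner v v)))"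
      by (simp add: dist_norm real_le_rsqrt)
  qed
  then have "bounded {y \<in> UNIV. ?G y \<le> ?G x0}" using bounded_cball bounded_subset by blast
  from lsc_fun_attains_min[OF lsc _ _ this] obtain p where p: "\<And>y. ?G p \<le> ?G y" by auto
  obtain b where b: "f p = ereal b"
    using p[of x0] f(1) by (cases "f p") (auto simp: a proper_fun_def)
  have sub: "f p + ereal (inner (z - p) (y - p)) \<le> f y" for y
  proof (cases "f y")
    case (real d)
    have *: "inner (z - p) (y - p) \<le> d - b + t * half_sq (y - p)" if t: "0 < t" "t < 1" for t
    proof -
      let ?y = "(1 - t) *\<^sub>R p + t *\<^sub>R y"
      have "f ?y \<le> ereal (1 - t) * f p + ereal t * f y"
        using f(3) t unfolding convex_fun_def by (metis add.commute diff_add_cancel diff_ge_0_iff_ge less_imp_le)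
      then have "f ?y \<le> ereal ((1 - t) * b + t * d)" by (simp add: real b)
      moreover have "half_sq (z - ?y) = half_sq (z - p) - t * inner (z - p) (y - p) + t * t * half_sq (y - p)"
      proof -
        have "z - ?y = (z - p) - t *\<^sub>R (y - p)" by (simp add: algebra_simps)
        then show ?thesis by (simp only: half_sq_diff[of "z - p"]) (simp add: half_sq_inner)
      qed
      ultimately have "b + half_sq (z - p) \<le>
          (1 - t) * b + t * d + (half_sq (z - p) - t * inner (z - p) (y - p) + t * t * half_sq (y - p))"
        using p[of ?y] by (cases "f ?y") (auto simp: b)
      then have "t * inner (z - p) (y - p) \<le> t * (d - b + t * half_sq (y - p))"
        by (simp add: algebra_simps)
      then show ?thesis using t by simp
    qed
    have "((\<lambda>t. d - b + t * half_sq (y - p)) \<longlongrightarrow> d - b + 0 * half_sq (y - p)) (at_right 0)"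
      by (intro tendsto_intros)
    moreover have "\<forall>\<^sub>F t in at_right (0::real). inner (z - p) (y - p) \<le> d - b + t * half_sq (y - p)"
      using * unfolding eventually_at_right_field by (intro exI[of _ 1]) auto
    ultimately have "inner (z - p) (y - p) \<le> d - b + 0 * half_sq (y - p)"
      by (intro tendsto_lowerbound) auto
    then show ?thesis by (simp add: real b)
  qed (use f(1) in \<open>auto simp: proper_fun_def\<close>)
  show ?thesis by (rule that[of p]) (use sub in \<open>simp add: subdifferential_def\<close>)
qed

text \<open>The infimum defining the envelope at \<open>z\<close> is attained at \<open>z - p\<close>, where equality holds in the
  Fenchel--Young inequality.\<close>

lemma moreau_envelope_conjugate_eq:
  assumes f: "proper_fun f" and u: "z - p \<in> subdifferential f p"
  shows "moreau_envelope (conjugate f) z + f p = ereal (inner z p - half_sq p)"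
proof -
  obtain a where a: "f p = ereal a"
    using subgradient_imp_finite[OF f u] by (metis ereal_real)
  have lower: "ereal (inner p y - a) \<le> conjugate f y" for y
    using SUP_upper[of p UNIV "\<lambda>x. ereal (inner x y) - f x"] by (simp add: conjugate_def a)
  have upper: "conjugate f (z - p) \<le> ereal (inner p (z - p) - a)"
    unfolding conjugate_def
  proof (rule SUP_least)
    fix x
    have "f p + ereal (inner (z - p) (x - p)) \<le> f x" using u by (simp add: subdifferential_def)
    then show "ereal (inner x (z - p)) - f x \<le> ereal (inner p (z - p) - a)"
      using f by (cases "f x") (auto simp: a inner_diff inner_commute proper_fun_def)
  qed
  have "moreau_envelope (conjugate f) z = ereal (inner z p - half_sq p - a)"
    unfolding moreau_envelope_def
  proof (rule antisym)
    have "(INF y. conjugate f y + ereal (half_sq (z - y))) \<le>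
        conjugate f (z - p) + ereal (half_sq (z - (z - p)))"
      by (rule INF_lower) simp
    also have "\<dots> \<le> ereal (inner p (z - p) - a) + ereal (half_sq (z - (z - p)))"
      using upper by (rule add_right_mono)
    also have "\<dots> = ereal (inner z p - half_sq p - a)"
      by (simp add: half_sq_inner inner_diff inner_commute field_simps)
    finally show "(INF y. conjugate f y + ereal (half_sq (z - y))) \<le> ereal (inner z p - half_sq p - a)" .
    show "ereal (inner z p - half_sq p - a) \<le> (INF y. conjugate f y + ereal (half_sq (z - y)))"
    proof (rule INF_greatest)
      fix y
      have "inner z p - half_sq p - a + half_sq (z - p - y) = inner p y - a + half_sq (z - y)"
        unfolding half_sq_inner inner_simps by (simp add: inner_commute field_simps)
      then have "inner z p - half_sq p - a \<le> inner p y - a + half_sq (z - y)"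
        using half_sq_nonneg[of "z - p - y"] by linarith
      then have "ereal (inner z p - half_sq p - a) \<le> ereal (inner p y - a) + ereal (half_sq (z - y))"
        by simp
      also have "\<dots> \<le> conjugate f y + ereal (half_sq (z - y))"
        using lower by (rule add_right_mono)
      finally show "ereal (inner z p - half_sq p - a) \<le> conjugate f y + ereal (half_sq (z - y))" .
    qed
  qed
  then show ?thesis by (simp add: a)
qed

text \<open>The elementary half of Minty's theorem: if \<open>Id + T\<close> is onto, a monotone \<open>T\<close> is maximal.\<close>

lemma maximally_monotoneI_surj:
  assumes T: "monotone_map T" and surj: "\<And>z. \<exists>p. z - p \<in> T p"
  shows "maximally_monotone T"
  unfolding maximally_monotone_def
proof (intro conjI T allI impI, elim conjE)
  fix S assume S: "monotone_map S" "\<forall>x. T x \<subseteq> S x"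
  have "u \<in> T x" if "u \<in> S x" for x u
  proof -
    obtain p where p: "(x + u) - p \<in> T p" using surj by blast
    then have "0 \<le> inner (x - p) (u - (x + u - p))"
      using S that unfolding monotone_map_def by blast
    then have "inner (x - p) (x - p) \<le> 0" by (simp add: inner_diff)
    then have "x = p" using inner_ge_zero[of "x - p"] by (metis antisym inner_eq_zero_iff eq_iff_diff_eq_0)
    then show ?thesis using p by simp
  qed
  then show "S = T" using S(2) by blast
qed

section \<open>Essentially smooth functions\<close>

lemma dom_funE:
  assumes "x \<in> dom_fun f"
  obtains a where "f x = ereal a"
  using assms by (cases "f x") (auto simp: dom_fun_def)

lemma convex_dom_fun:
  assumes f: "proper_fun f" "convex_fun f"
  shows "convex (dom_fun f)"
  unfolding convex_def
proof (intro ballI allI impI)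
  fix x y and u v :: real
  assume xy: "x \<in> dom_fun f" "y \<in> dom_fun f" and uv: "0 \<le> u" "0 \<le> v" "u + v = 1"
  obtain a b where ab: "f x = ereal a" "f y = ereal b"
    using xy by (blast elim: dom_funE)
  have "f (u *\<^sub>R x + v *\<^sub>R y) \<le> ereal u * f x + ereal v * f y"
    using f(2) uv unfolding convex_fun_def by blast
  then show "u *\<^sub>R x + v *\<^sub>R y \<in> dom_fun f"
    using f(1) by (cases "f (u *\<^sub>R x + v *\<^sub>R y)") (auto simp: ab dom_fun_def proper_fun_def)
qed

lemma differentiable_imp_GDERIV:
  fixes g :: "'a::euclidean_space \<Rightarrow> real"
  assumes "g differentiable (at x)"
  obtains D where "GDERIV g x :> D"
proof -
  obtain g' where g': "(g has_derivative g') (at x)"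
    using assms by (auto simp: differentiable_def)
  have lin: "linear g'" using g' by (rule has_derivative_linear)
  have "g' h = inner h (\<Sum>b\<in>Basis. g' b *\<^sub>R b)" for h
  proof -
    have "g' h = g' (\<Sum>b\<in>Basis. inner h b *\<^sub>R b)" by (simp add: euclidean_representation)
    also have "\<dots> = (\<Sum>b\<in>Basis. inner h b * g' b)"
      using lin by (simp add: linear_sum linear_scale)
    finally show ?thesis by (simp add: inner_sum_right mult.commute)
  qed
  then have "g' = (\<lambda>h. inner h (\<Sum>b\<in>Basis. g' b *\<^sub>R b))" by blast
  with g' that show ?thesis unfolding gderiv_def by metis
qed

lemma GDERIV_imp_gradient:
  assumes "GDERIV (\<lambda>y. real_of_ereal (f y)) x :> D"
  shows "gradient f x = D"
  unfolding gradient_def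
proof (rule the_equality[where P = "\<lambda>D. GDERIV (\<lambda>y. real_of_ereal (f y)) x :> D", OF assms])
  fix E assume "GDERIV (\<lambda>y. real_of_ereal (f y)) x :> E"
  then have "(\<lambda>h. inner h E) = (\<lambda>h. inner h D)"
    using assms has_derivative_unique unfolding gderiv_def by blast
  then have "inner (E - D) (E - D) = 0" by (metis cancel_comm_monoid_add_class.diff_cancel inner_diff_right)
  then show "E = D" by simp
qed

text \<open>The point \<open>x\<close> need not be interior: along a segment to a point of the domain \<open>f\<close> is
  finite by convexity.\<close>

lemma GDERIV_imp_subgradient:
  assumes f: "proper_fun f" "convex_fun f" and x: "\<bar>f x\<bar> \<noteq> \<infinity>"
    and D: "GDERIV (\<lambda>y. real_of_ereal (f y)) x :> D"
  shows "D \<in> subdifferential f x"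
  unfolding subdifferential_def
proof (intro CollectI allI)
  fix y
  obtain a where a: "f x = ereal a" using x by (metis ereal_real)
  show "f x + ereal (inner D (y - x)) \<le> f y"
  proof (cases "f y")
    case (real b)
    define g where "g y = real_of_ereal (f y)" for y
    let ?\<phi> = "\<lambda>t. g (x + t *\<^sub>R (y - x))"
    have "((\<lambda>t. x + t *\<^sub>R (y - x)) has_derivative (\<lambda>t. t *\<^sub>R (y - x))) (at 0)"
      by (auto intro!: derivative_eq_intros)
    moreover have "(g has_derivative (\<lambda>h. inner h D)) (at (x + 0 *\<^sub>R (y - x)))"
      using D by (simp add: gderiv_def g_def[abs_def])
    ultimately have "(?\<phi> has_derivative (\<lambda>t. inner (t *\<^sub>R (y - x)) D)) (at 0)"
      by (rule has_derivative_compose)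
    then have "(?\<phi> has_real_derivative inner D (y - x)) (at 0)"
      unfolding has_field_derivative_def
      by (rule has_derivative_eq_rhs) (auto simp: inner_commute mult.commute)
    then have "((\<lambda>t. (?\<phi> t - ?\<phi> 0) / t) \<longlongrightarrow> inner D (y - x)) (at 0)"
      by (simp add: DERIV_def)
    then have "((\<lambda>t. (?\<phi> t - ?\<phi> 0) / t) \<longlongrightarrow> inner D (y - x)) (at_right 0)"
      by (rule filterlim_mono) (auto simp: at_le)
    moreover have "(?\<phi> t - ?\<phi> 0) / t \<le> b - a" if t: "0 < t" "t < 1" for t
    proof -
      have eq: "x + t *\<^sub>R (y - x) = (1 - t) *\<^sub>R x + t *\<^sub>R y" by (simp add: algebra_simps)
      have "f ((1 - t) *\<^sub>R x + t *\<^sub>R y) \<le> ereal (1 - t) * f x + ereal t * f y"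
        using f(2) t unfolding convex_fun_def
        by (metis add.commute diff_add_cancel diff_ge_0_iff_ge less_imp_le)
      then have "?\<phi> t \<le> (1 - t) * a + t * b"
        using f(1) unfolding eq g_def
        by (cases "f ((1 - t) *\<^sub>R x + t *\<^sub>R y)") (auto simp: a real proper_fun_def)
      moreover have "?\<phi> 0 = a" by (simp add: g_def a)
      ultimately have "?\<phi> t - ?\<phi> 0 \<le> (b - a) * t" by argo
      then show ?thesis using t by (simp only: pos_divide_le_eq)
    qed
    then have "\<forall>\<^sub>F t in at_right 0. (?\<phi> t - ?\<phi> 0) / t \<le> b - a"
      unfolding eventually_at_right_field by (intro exI[of _ 1]) auto
    ultimately have "inner D (y - x) \<le> b - a"
      by (intro tendsto_upperbound) auto
    then show ?thesis by (simp add: a real)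
  qed (use f(1) in \<open>auto simp: proper_fun_def\<close>)
qed

lemma subgradient_eq_GDERIV:
  assumes x: "x \<in> interior (dom_fun f)" and u: "u \<in> subdifferential f x"
    and D: "GDERIV (\<lambda>y. real_of_ereal (f y)) x :> D"
  shows "u = D"
proof -
  let ?g = "\<lambda>y. real_of_ereal (f y) - inner y u"
  have der: "(?g has_derivative (\<lambda>h. inner h D - inner h u)) (at x)"
    using D unfolding gderiv_def by (auto intro!: derivative_eq_intros)
  have "\<forall>\<^sub>F y in at x. y \<in> interior (dom_fun f)"
    using x by (intro eventually_at_in_open') auto
  then have "\<forall>\<^sub>F y in at x. ?g x \<le> ?g y"
  proof eventually_elim
    case (elim y)
    obtain a b where "f x = ereal a" "f y = ereal b"
      using x elim interior_subset by (blast elim: dom_funE)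
    moreover have "f x + ereal (inner u (y - x)) \<le> f y" using u by (simp add: subdifferential_def)
    ultimately show ?case by (simp add: inner_diff inner_commute)
  qed
  from has_derivative_local_min[OF der this] have "inner (D - u) D - inner (D - u) u = 0" by metis
  then have "inner (D - u) (D - u) = 0" by (simp add: inner_diff_right)
  then show "u = D" by simp
qed

lemma bounded_above_near_differentiable:
  assumes x: "x \<in> interior (dom_fun f)"
    and d: "(\<lambda>y. real_of_ereal (f y)) differentiable (at x)"
  obtains \<epsilon> M where "0 < \<epsilon>" "\<And>y. norm (y - x) \<le> \<epsilon> \<Longrightarrow> f y \<le> ereal M"
proof -
  let ?g = "\<lambda>y. real_of_ereal (f y)"
  have "isCont ?g x" using d by (rule differentiable_imp_continuous_within)
  then have "(?g \<longlongrightarrow> ?g x) (nhds x)"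
    unfolding isCont_def by (rule tendsto_at_iff_tendsto_nhds[where g = ?g, THEN iffD1])
  then have "\<forall>\<^sub>F y in nhds x. ?g y < ?g x + 1"
    by (rule order_tendstoD(2)) simp
  moreover have "\<forall>\<^sub>F y in nhds x. y \<in> interior (dom_fun f)"
    using x by (intro eventually_nhds_in_open) auto
  ultimately have "\<forall>\<^sub>F y in nhds x. f y \<le> ereal (?g x + 1)"
  proof eventually_elim
    case (elim y)
    then obtain b where "f y = ereal b"
      using interior_subset by (blast elim: dom_funE)
    with elim show ?case by simp
  qed
  then obtain e where e: "e > 0" "\<And>y. dist y x < e \<Longrightarrow> f y \<le> ereal (?g x + 1)"
    by (auto simp: eventually_nhds_metric)
  show ?thesis
    by (rule that[of "e / 2" "?g x + 1"]) (use e in \<open>auto simp: dist_norm\<close>)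
qed

lemma essentially_smoothD:
  assumes "essentially_smooth f"
  shows "interior (dom_fun f) \<noteq> {}"
    "x \<in> interior (dom_fun f) \<Longrightarrow> (\<lambda>y. real_of_ereal (f y)) differentiable (at x)"
    "(\<And>i::nat. X i \<in> interior (dom_fun f)) \<Longrightarrow> x \<in> frontier (interior (dom_fun f)) \<Longrightarrow> X \<longlonglongrightarrow> x \<Longrightarrow>
       filterlim (\<lambda>i. norm (gradient f (X i))) at_top sequentially"
  using assms by (auto simp: essentially_smooth_def Let_def)

text \<open>An essentially smooth convex function has no subgradients at boundary points of its domain.
  If \<open>u\<close> were one at \<open>x\<close>, the gradients \<open>D\<close> at the points \<open>x - t (x - y0)\<close>, with \<open>y0\<close> interior and
  \<open>t \<rightarrow> 0\<close>, would stay bounded: evaluate the subgradient inequality for \<open>D\<close> at the point of a small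
  ball around \<open>y0\<close> that is farthest in the direction of \<open>D\<close>, where \<open>f\<close> is bounded above, and use
  monotonicity against \<open>u\<close> to bound \<open>inner D (y0 - x)\<close> from below.\<close>

lemma essentially_smooth_subgradient_interior:
  fixes f :: "'a::euclidean_space \<Rightarrow> ereal"
  assumes f: "proper_fun f" "convex_fun f" and smooth: "essentially_smooth f"
    and u: "u \<in> subdifferential f x"
  shows "x \<in> interior (dom_fun f)"
proof (rule ccontr)
  let ?C = "interior (dom_fun f)"
  assume x: "x \<notin> ?C"
  obtain y0 where y0: "y0 \<in> ?C" using essentially_smoothD(1)[OF smooth] by blast
  obtain \<epsilon> M where \<epsilon>: "0 < \<epsilon>" and M: "\<And>y. norm (y - y0) \<le> \<epsilon> \<Longrightarrow> f y \<le> ereal M"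
    using bounded_above_near_differentiable[OF y0 essentially_smoothD(2)[OF smooth y0]] by blast
  have xdom: "x \<in> dom_fun f" using subgradient_imp_finite[OF f(1) u] by (simp add: dom_fun_def)
  obtain a where a: "f x = ereal a"
    using subgradient_imp_finite[OF f(1) u] by (metis ereal_real)
  define t :: "nat \<Rightarrow> real" where "t i = 1 / real (Suc i)" for i
  have t: "0 < t i" "t i \<le> 1" for i by (auto simp: t_def divide_simps)
  have t0: "t \<longlonglongrightarrow> 0" unfolding t_def using LIMSEQ_Suc[OF lim_1_over_n] by simp
  define X where "X i = x - t i *\<^sub>R (x - y0)" for i
  have XC: "X i \<in> ?C" for i
    unfolding X_def by (rule mem_interior_convex_shrink[OF convex_dom_fun[OF f] y0 xdom t])
  have "X \<longlonglongrightarrow> x - 0 *\<^sub>R (x - y0)" unfolding X_def by (intro tendsto_intros t0)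
  then have Xx: "X \<longlonglongrightarrow> x" by simp
  then have "x \<in> closure ?C" using XC closure_sequential by blast
  then have "x \<in> frontier ?C" using x by (simp add: frontier_def)
  from essentially_smoothD(3)[OF smooth XC this Xx]
  have lim: "filterlim (\<lambda>i. norm (gradient f (X i))) at_top sequentially" .
  define B where "B = (M - a + 2 * \<bar>inner u (y0 - x)\<bar>) / \<epsilon>"
  have "norm (gradient f (X i)) \<le> B" for i
  proof -
    obtain D where "GDERIV (\<lambda>y. real_of_ereal (f y)) (X i) :> D"
      using differentiable_imp_GDERIV essentially_smoothD(2)[OF smooth XC] by blast
    then have D: "gradient f (X i) = D" "D \<in> subdifferential f (X i)"
      using GDERIV_imp_gradient GDERIV_imp_subgradient[OF f] XC[of i] interior_subset[of "dom_fun f"]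
      by (auto simp: dom_fun_def)
    obtain b where b: "f (X i) = ereal b"
      using subgradient_imp_finite[OF f(1) D(2)] by (metis ereal_real)
    define w where "w = y0 + \<epsilon> *\<^sub>R sgn D"
    have "norm (w - y0) \<le> \<epsilon>" using \<epsilon> by (simp add: w_def norm_sgn)
    then have "f w \<le> ereal M" by (rule M)
    moreover have "f (X i) + ereal (inner D (w - X i)) \<le> f w"
      using D(2) by (simp add: subdifferential_def)
    ultimately have "f (X i) + ereal (inner D (w - X i)) \<le> ereal M" by (rule order_trans[rotated])
    then have 1: "b + inner D (w - X i) \<le> M" by (simp add: b)
    have "w - X i = (1 - t i) *\<^sub>R (y0 - x) + \<epsilon> *\<^sub>R sgn D"
      by (simp add: w_def X_def algebra_simps)
    then have 2: "inner D (w - X i) = (1 - t i) * inner D (y0 - x) + \<epsilon> * norm D"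
      by (simp add: inner_add_right inner_sgn_self)
    have "0 \<le> inner (X i - x) (D - u)"
      using monotone_subdifferential[OF f(1)] D(2) u unfolding monotone_map_def by blast
    also have "inner (X i - x) (D - u) = t i * (inner D (y0 - x) - inner u (y0 - x))"
      by (simp add: X_def inner_diff inner_commute algebra_simps)
    finally have "inner u (y0 - x) \<le> inner D (y0 - x)" using t[of i] by (simp add: zero_le_mult_iff)
    then have 3: "(1 - t i) * inner u (y0 - x) \<le> (1 - t i) * inner D (y0 - x)"
      using t[of i] by (intro mult_left_mono) auto
    have "f x + ereal (inner u (X i - x)) \<le> f (X i)" using u by (simp add: subdifferential_def)
    moreover have "inner u (X i - x) = t i * inner u (y0 - x)"
      by (simp add: X_def inner_diff algebra_simps)
    ultimately have 4: "a + t i * inner u (y0 - x) \<le> b" by (simp add: a b)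
    have "a + inner u (y0 - x) + \<epsilon> * norm D \<le> M"
      using 1 2 3 4 by (simp add: algebra_simps)
    then have "\<epsilon> * norm D \<le> M - a + 2 * \<bar>inner u (y0 - x)\<bar>" by linarith
    then show ?thesis using \<epsilon> by (simp add: B_def D(1) le_divide_eq mult.commute)
  qed
  moreover have "\<forall>\<^sub>F i in sequentially. B < norm (gradient f (X i))"
    using lim by (simp add: filterlim_at_top_dense)
  ultimately have "\<forall>\<^sub>F i::nat in sequentially. False" by (simp add: not_less[symmetric])
  then show False by simp
qed

section \<open>The pairwise-product cost\<close>

text \<open>The identity \<open>2 \<Sum>\<^sub>i\<^sub><\<^sub>j \<langle>x\<^sub>i, x\<^sub>j\<rangle> = |\<Sum>\<^sub>i x\<^sub>i|\<^sup>2 - \<Sum>\<^sub>i |x\<^sub>i|\<^sup>2\<close>, by splitting the pairs of indices into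
  those below, above and on the diagonal.\<close>

lemma cost_eq_half_sq:
  fixes x :: "'a::real_inner ^ 'k::{finite,linorder}"
  shows "cost x = half_sq (\<Sum>i\<in>UNIV. x $ i) - (\<Sum>i\<in>UNIV. half_sq (x $ i))"
proof -
  let ?p = "\<lambda>(i, j). inner (x $ i) (x $ j)"
  let ?L = "{(i, j). i < j} :: ('k \<times> 'k) set"
  let ?G = "{(i, j). j < i} :: ('k \<times> 'k) set"
  let ?E = "(\<lambda>i. (i, i)) ` UNIV :: ('k \<times> 'k) set"
  have un: "UNIV = ?L \<union> ?G \<union> ?E" by (auto simp: neq_iff)
  have "inner (\<Sum>i\<in>UNIV. x $ i) (\<Sum>i\<in>UNIV. x $ i) = (\<Sum>i\<in>UNIV. \<Sum>j\<in>UNIV. ?p (i, j))"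
    by (simp add: inner_sum_left inner_sum_right) (rule sum.swap)
  also have "\<dots> = sum ?p UNIV" by (simp add: sum.cartesian_product)
  also have "\<dots> = sum ?p (?L \<union> ?G) + sum ?p ?E"
    by (subst un, rule sum.union_disjoint) auto
  also have "sum ?p (?L \<union> ?G) = sum ?p ?L + sum ?p ?G"
    by (rule sum.union_disjoint) auto
  also have "sum ?p ?G = sum ?p ?L"
    by (rule sum.reindex_bij_witness[where i = prod.swap and j = prod.swap]) (auto simp: inner_commute)
  also have "sum ?p ?E = (\<Sum>i\<in>UNIV. inner (x $ i) (x $ i))"
    by (subst sum.reindex) (auto simp: inj_on_def)
  finally show ?thesis
    by (simp add: cost_def half_sq_inner sum_divide_distrib[symmetric] field_simps)
qed

lemma cost_replace:
  fixes x :: "'a::real_inner ^ 'k::{finite,linorder}"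
  shows "cost (\<chi> j. if j = i then y else x $ j) =
    cost x + inner ((\<Sum>j\<in>UNIV. x $ j) - x $ i) (y - x $ i)"
proof -
  let ?s = "\<Sum>j\<in>UNIV - {i}. x $ j"
  have split: "(\<Sum>j\<in>UNIV. g j) = g i + (\<Sum>j\<in>UNIV - {i}. g j)" for g :: "'k \<Rightarrow> 'b::comm_monoid_add"
    by (rule sum.remove) auto
  show ?thesis
    unfolding cost_eq_half_sq
    by (simp add: split half_sq_inner inner_simps inner_commute field_simps)
qed

lemma sum_others_eq:
  fixes x :: "'a::real_inner ^ 'k::finite"
  shows "(\<Sum>j\<in>UNIV - {i}. x $ j) = (\<Sum>j\<in>UNIV. x $ j) - x $ i"
  by (simp add: sum_diff1)

section \<open>The contact set\<close>

text \<open>Throughout, \<open>f\<close> is a family of proper functions whose direct sum dominates the cost.\<close>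

context
  fixes f :: "'k::{finite,linorder} \<Rightarrow> 'a::euclidean_space \<Rightarrow> ereal"
  assumes proper: "\<And>i. proper_fun (f i)"
    and cost_le: "\<And>x. ereal (cost x) \<le> (\<Sum>i\<in>UNIV. f i (x $ i))"
begin

lemma not_MInf: "f i y \<noteq> -\<infinity>"
  using proper[of i] by (simp add: proper_fun_def)

lemma eq_ereal_real: "f i y \<noteq> \<infinity> \<Longrightarrow> f i y = ereal (real_of_ereal (f i y))"
  using not_MInf by (cases "f i y") auto

lemma finite_of_sum_le:
  assumes "(\<Sum>i\<in>UNIV. f i (x $ i)) \<le> ereal c"
  obtains r where "\<And>i. f i (x $ i) = ereal (r i)"
proof -
  have "(\<Sum>i\<in>UNIV. f i (x $ i)) \<noteq> \<infinity>" using assms by auto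
  then have "f i (x $ i) \<noteq> \<infinity>" for i by (auto simp: sum_Pinfty)
  then have "f i (x $ i) = ereal (real_of_ereal (f i (x $ i)))" for i
    by (rule eq_ereal_real)
  from that[OF this] show ?thesis .
qed

text \<open>Freezing all coordinates but one at points of finite value turns the inequality against the
  cost into an affine minorant of the remaining function. Its slope is the sum of the frozen
  coordinates.\<close>

lemma affine_minorant_slice:
  assumes r: "\<And>j. j \<noteq> i \<Longrightarrow> f j (x $ j) = ereal (r j)"
  shows "ereal (cost x - (\<Sum>j\<in>UNIV - {i}. r j) + inner ((\<Sum>j\<in>UNIV. x $ j) - x $ i) (y - x $ i))
    \<le> f i y"
proof -
  let ?x = "\<chi> j. if j = i then y else x $ j"
  have "(\<Sum>j\<in>UNIV. f j (?x $ j)) = f i y + (\<Sum>j\<in>UNIV - {i}. f j (?x $ j))"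
    by (subst sum.remove[of _ i]) auto
  also have "(\<Sum>j\<in>UNIV - {i}. f j (?x $ j)) = (\<Sum>j\<in>UNIV - {i}. ereal (r j))"
    by (rule sum.cong) (auto simp: r)
  finally have "ereal (cost ?x) \<le> f i y + ereal (\<Sum>j\<in>UNIV - {i}. r j)"
    using cost_le[of ?x] by simp
  then show ?thesis
    unfolding cost_replace using not_MInf by (cases "f i y") auto
qed

lemma affine_minorants:
  obtains v c where "\<And>i y. ereal (inner (v i) y + c i) \<le> f i y"
proof -
  have "\<exists>d. f i d \<noteq> \<infinity>" for i using proper[of i] by (simp add: proper_fun_def)
  then obtain d where d: "\<And>i. f i (d i) \<noteq> \<infinity>" by metis
  define x where "x = (\<chi> i. d i)"
  have r: "f i (x $ i) = ereal (real_of_ereal (f i (x $ i)))" for i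
    by (rule eq_ereal_real) (simp add: x_def d)
  define v where "v i = (\<Sum>j\<in>UNIV. x $ j) - x $ i" for i
  define c where "c i = cost x - (\<Sum>j\<in>UNIV - {i}. real_of_ereal (f j (x $ j))) - inner (v i) (x $ i)" for i
  have "ereal (inner (v i) y + c i) \<le> f i y" for i y
    using affine_minorant_slice[OF r, where i = i and y = y]
    by (simp add: v_def c_def inner_diff_right algebra_simps)
  then show ?thesis by (rule that)
qed

lemma contact_finite:
  assumes "x \<in> contact_set f"
  obtains r where "\<And>i. f i (x $ i) = ereal (r i)" "(\<Sum>i\<in>UNIV. r i) = cost x"
proof -
  have eq: "(\<Sum>i\<in>UNIV. f i (x $ i)) = ereal (cost x)" using assms by (simp add: contact_set_def)
  then obtain r where r: "\<And>i. f i (x $ i) = ereal (r i)"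
    using finite_of_sum_le by (metis order_refl)
  show ?thesis by (rule that[of r]) (use eq in \<open>simp_all add: r\<close>)
qed

text \<open>On the contact set the affine minorant is exact, so its slope is a subgradient.\<close>

lemma contact_subgradient:
  assumes "x \<in> contact_set f"
  shows "(\<Sum>j\<in>UNIV. x $ j) - x $ i \<in> subdifferential (f i) (x $ i)"
proof -
  obtain r where r: "\<And>i. f i (x $ i) = ereal (r i)" "(\<Sum>i\<in>UNIV. r i) = cost x"
    using contact_finite[OF assms] by blast
  have "cost x = r i + (\<Sum>j\<in>UNIV - {i}. r j)"
    unfolding r(2)[symmetric] by (rule sum.remove) auto
  then show ?thesis
    using affine_minorant_slice[OF r(1), where i = i]
    by (simp add: subdifferential_def r(1))
qed

text \<open>The supremum defining \<open>f i0 p\<close> is attained as soon as \<open>f i0\<close> is bounded above near \<open>p\<close>. Attainment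
  means that the gap \<open>F\<close> between the sum of the \<open>f i\<close> and the cost, whose infimum over the
  slice \<open>S\<close> of all \<open>x\<close> with \<open>x $ i0 = p\<close> is \<open>0\<close>, has a minimizer on \<open>S\<close>; for this the sublevel set
  of level \<open>1\<close> is shown to be bounded. There, the affine minorant of \<open>f i0\<close> with slope \<open>s\<close>, the sum
  of the other coordinates, falls short of \<open>f i0 p\<close> by at most \<open>1\<close> at \<open>p\<close>, so the upper bound \<open>M\<close> on
  a ball bounds \<open>s\<close>. Then the cost differs by a bounded amount from \<open>- (\<Sum>i\<in>UNIV. half_sq (x $ i))\<close>,
  and affine minorants of all the \<open>f i\<close> bound \<open>x\<close>.\<close>

lemma contact_attained:
  assumes lsc: "\<And>i. lsc_fun (f i)"
    and sup: "f i0 p = (SUP x\<in>{x. x $ i0 = p}. ereal (cost x) - (\<Sum>i\<in>UNIV - {i0}. f i (x $ i)))"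
    and eps: "0 < \<epsilon>" and M: "\<And>y. norm (y - p) \<le> \<epsilon> \<Longrightarrow> f i0 y \<le> ereal M"
  obtains x where "x \<in> contact_set f" "x $ i0 = p"
proof -
  have "f i0 p \<le> ereal M" using M[of p] eps by simp
  then obtain P where P: "f i0 p = ereal P" using not_MInf by (cases "f i0 p") auto
  define F where "F x = (\<Sum>i\<in>UNIV. f i (x $ i)) + ereal (- cost x)" for x
  define S where "S = {x. x $ i0 = p}"
  have sum_ne: "(\<Sum>i\<in>UNIV. f i (x $ i)) \<noteq> -\<infinity>" for x
    using cost_le[of x] by auto
  have "isCont cost x" for x :: "('a, 'k) vec"
    unfolding cost_def[abs_def] case_prod_beta by (intro continuous_intros)
  then have lscF: "lsc_fun F"
    unfolding F_def using not_MInf sum_ne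
    by (intro lsc_fun_add lsc_fun_sum lsc_fun_ereal lsc_fun_compose[OF lsc]) (auto intro!: continuous_intros)
  have small: "\<exists>x\<in>S. F x \<le> ereal \<delta>" if "0 < \<delta>" for \<delta>
  proof -
    have "ereal (P - \<delta>) < f i0 p" using that by (simp add: P)
    then obtain x where x: "x $ i0 = p" "ereal (P - \<delta>) < ereal (cost x) - (\<Sum>i\<in>UNIV - {i0}. f i (x $ i))"
      unfolding sup less_SUP_iff by auto
    have "(\<Sum>i\<in>UNIV. f i (x $ i)) = ereal P + (\<Sum>i\<in>UNIV - {i0}. f i (x $ i))"
      by (subst sum.remove[of _ i0]) (auto simp: x(1) P)
    then have "F x \<le> ereal \<delta>"
      using x(2) sum_ne[of x] unfolding F_def
      by (cases "\<Sum>i\<in>UNIV - {i0}. f i (x $ i)") auto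
    then show ?thesis using x(1) by (auto simp: S_def)
  qed
  obtain v c where vc: "\<And>i y. ereal (inner (v i) y + c i) \<le> f i y"
    using affine_minorants by blast
  define B where "B = norm p + (M + 1 - P) / \<epsilon>"
  define K where "K = 4 * (1 + B\<^sup>2 / 2 - (\<Sum>i\<in>UNIV. c i - inner (v i) (v i)))"
  have bound: "norm x \<le> sqrt K" if x: "x \<in> S" "F x \<le> ereal 1" for x
  proof -
    have xp: "x $ i0 = p" using x by (simp add: S_def)
    have sum_le: "(\<Sum>i\<in>UNIV. f i (x $ i)) \<le> ereal (cost x + 1)"
      using x(2) unfolding F_def by (cases "\<Sum>i\<in>UNIV. f i (x $ i)") auto
    then obtain r where r: "\<And>i. f i (x $ i) = ereal (r i)" using finite_of_sum_le by blast
    have r_le: "(\<Sum>i\<in>UNIV. r i) \<le> cost x + 1" using sum_le by (simp add: r)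
    have r_split: "(\<Sum>i\<in>UNIV. r i) = P + (\<Sum>i\<in>UNIV - {i0}. r i)"
      using r[of i0] by (subst sum.remove[of _ i0]) (auto simp: xp P)
    \<comment> \<open>Move in the direction of \<open>s\<close>, as far as the ball allows.\<close>
    define s where "s = (\<Sum>j\<in>UNIV. x $ j) - p"
    have "norm (p + \<epsilon> *\<^sub>R sgn s - p) \<le> \<epsilon>" using eps by (simp add: norm_sgn)
    then have "f i0 (p + \<epsilon> *\<^sub>R sgn s) \<le> ereal M" by (rule M)
    with affine_minorant_slice[OF r, where i = i0 and y = "p + \<epsilon> *\<^sub>R sgn s"]
    have "ereal (cost x - (\<Sum>j\<in>UNIV - {i0}. r j) + inner s (\<epsilon> *\<^sub>R sgn s)) \<le> ereal M"
      unfolding xp s_def[symmetric] by (metis add_diff_cancel_left' order_trans)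
    then have "\<epsilon> * norm s \<le> M + 1 - P" using r_le r_split by (simp add: inner_sgn_self)
    then have "norm s \<le> (M + 1 - P) / \<epsilon>" using eps by (simp add: le_divide_eq mult.commute)
    then have "norm (\<Sum>j\<in>UNIV. x $ j) \<le> B"
      using norm_triangle_ineq[of s p] by (simp add: s_def B_def)
    then have "half_sq (\<Sum>j\<in>UNIV. x $ j) \<le> B\<^sup>2 / 2"
      by (simp add: half_sq_def power_mono)
    then have "(\<Sum>i\<in>UNIV. r i) + (\<Sum>i\<in>UNIV. half_sq (x $ i)) \<le> 1 + B\<^sup>2 / 2"
      using r_le unfolding cost_eq_half_sq by simp
    moreover have "c i - inner (v i) (v i) + inner (x $ i) (x $ i) / 4 \<le> r i + half_sq (x $ i)" for i
    proof -
      \<comment> \<open>Half of the quadratic term absorbs the linear part of the minorant.\<close>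
      have "0 \<le> inner (v i + (1/2) *\<^sub>R x $ i) (v i + (1/2) *\<^sub>R x $ i)" by simp
      then have "- inner (v i) (v i) - inner (x $ i) (x $ i) / 4 \<le> inner (v i) (x $ i)"
        unfolding inner_simps by (simp add: inner_commute field_simps)
      moreover have "inner (v i) (x $ i) + c i \<le> r i" using vc[of i "x $ i"] by (simp add: r)
      ultimately show ?thesis by (simp add: half_sq_inner field_simps)
    qed
    then have "(\<Sum>i\<in>UNIV. c i - inner (v i) (v i) + inner (x $ i) (x $ i) / 4)
        \<le> (\<Sum>i\<in>UNIV. r i + half_sq (x $ i))" by (intro sum_mono)
    ultimately have "(\<Sum>i\<in>UNIV. inner (x $ i) (x $ i)) \<le> K"
      by (simp add: sum.distrib sum_divide_distrib[symmetric] K_def)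
    then have "(norm x)\<^sup>2 \<le> K" by (simp add: power2_norm_eq_inner inner_vec_def)
    then show ?thesis by (rule real_le_rsqrt)
  qed
  obtain x0 where x0: "x0 \<in> S" "F x0 \<le> ereal 1" using small[of 1] by auto
  have "{x \<in> S. F x \<le> F x0} \<subseteq> cball 0 (sqrt K)"
    using bound x0(2) by (auto intro: order_trans)
  then have "bounded {x \<in> S. F x \<le> F x0}" using bounded_cball bounded_subset by blast
  moreover have "closed S" unfolding S_def
    by (intro closed_Collect_eq continuous_intros)
  ultimately obtain x where x: "x \<in> S" "\<And>y. y \<in> S \<Longrightarrow> F x \<le> F y"
    using lsc_fun_attains_min[OF lscF _ x0(1)] by blast
  have "F x \<le> 0 + ereal \<delta>" if "0 < \<delta>" for \<delta>
    using small[OF that] x(2) by (auto intro: order_trans)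
  then have "F x \<le> 0" by (rule ereal_le_epsilon2)
  then have "(\<Sum>i\<in>UNIV. f i (x $ i)) \<le> ereal (cost x)"
    unfolding F_def by (cases "\<Sum>i\<in>UNIV. f i (x $ i)") auto
  with cost_le[of x] have "x \<in> contact_set f" by (simp add: contact_set_def)
  with x(1) that show ?thesis by (simp add: S_def)
qed

text \<open>The core of the argument. Given \<open>z\<close>, the resolvent point \<open>p\<close> of the essentially smooth
  \<open>f i0\<close> is interior to its domain, so a contact point \<open>x\<close> lies above it. Both \<open>z - p\<close> and the sum of the
  other coordinates of \<open>x\<close> are subgradients of \<open>f i0\<close> at \<open>p\<close>, hence equal to the gradient
  there.\<close>

lemma essentially_smooth_sum_set_contact:
  assumes f: "\<And>i. f i \<in> proper_lsc_convex"
    and sup: "\<And>p. f i0 p = (SUP x\<in>{x. x $ i0 = p}. ereal (cost x) - (\<Sum>i\<in>UNIV - {i0}. f i (x $ i)))"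
    and smooth: "essentially_smooth (f i0)"
  shows "sum_set (contact_set f) = UNIV"
proof -
  have "z \<in> sum_set (contact_set f)" for z
  proof -
    obtain v c where "\<And>i y. ereal (inner (v i) y + c i) \<le> f i y"
      using affine_minorants by blast
    then obtain p where p: "z - p \<in> subdifferential (f i0) p"
      using subgradient_exists_resolvent[OF f] by blast
    have int: "p \<in> interior (dom_fun (f i0))"
      using essentially_smooth_subgradient_interior[OF proper _ smooth p] proper_lsc_convexD[OF f] by blast
    note diff = essentially_smoothD(2)[OF smooth int]
    obtain \<epsilon> M where "0 < \<epsilon>" "\<And>y. norm (y - p) \<le> \<epsilon> \<Longrightarrow> f i0 y \<le> ereal M"
      using bounded_above_near_differentiable[OF int diff] by blast
    then obtain x where x: "x \<in> contact_set f" "x $ i0 = p"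
      using contact_attained[OF proper_lsc_convexD(2)[OF f] sup] by metis
    obtain D where D: "GDERIV (\<lambda>y. real_of_ereal (f i0 y)) p :> D"
      using differentiable_imp_GDERIV[OF diff] .
    have "(\<Sum>j\<in>UNIV. x $ j) - p = D"
      using subgradient_eq_GDERIV[OF int _ D] contact_subgradient[OF x(1), of i0] x(2) by simp
    moreover have "z - p = D" by (rule subgradient_eq_GDERIV[OF int p D])
    ultimately have "(\<Sum>j\<in>UNIV. x $ j) = z" by (metis diff_add_cancel)
    then show ?thesis using x(1) by (auto simp: sum_set_def)
  qed
  then show ?thesis by blast
qed

section \<open>Consequences of the surjectivity of the sum\<close>

context
  assumes sum_onto: "sum_set (contact_set f) = UNIV"
begin

lemma contact_of_sum:
  obtains x where "x \<in> contact_set f" "(\<Sum>j\<in>UNIV. x $ j) = z"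
proof -
  have "z \<in> sum_set (contact_set f)" using sum_onto by simp
  then show ?thesis using that by (auto simp: sum_set_def)
qed

text \<open>A subgradient \<open>u\<close> at \<open>p\<close> comes from the contact point with sum \<open>u + p\<close>: its \<open>i\<close>-th coordinate
  and \<open>p\<close> are both the proximal point of \<open>u + p\<close>.\<close>

lemma marginal_map_contact: "marginal_map (contact_set f) i = subdifferential (f i)"
proof (intro ext set_eqI iffI)
  fix p u assume "u \<in> marginal_map (contact_set f) i p"
  then obtain x where "x \<in> contact_set f" "x $ i = p" "u = (\<Sum>j\<in>UNIV - {i}. x $ j)"
    by (auto simp: marginal_map_def)
  then show "u \<in> subdifferential (f i) p"
    using contact_subgradient[of x i] by (simp add: sum_others_eq)
next
  fix p u assume u: "u \<in> subdifferential (f i) p"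
  obtain x where x: "x \<in> contact_set f" "(\<Sum>j\<in>UNIV. x $ j) = u + p"
    using contact_of_sum .
  have "Prox (f i) (u + p) = x $ i"
    using Prox_eqI[OF proper contact_subgradient[OF x(1)]] x(2) by metis
  moreover have "Prox (f i) (u + p) = p" using u by (intro Prox_eqI[OF proper]) simp
  ultimately have "x $ i = p" by simp
  moreover have "u = (\<Sum>j\<in>UNIV - {i}. x $ j)" unfolding sum_others_eq using x(2) calculation by simp
  ultimately show "u \<in> marginal_map (contact_set f) i p"
    using x(1) by (auto simp: marginal_map_def)
qed

lemma maximally_monotone_marginal: "maximally_monotone (marginal_map (contact_set f) i)"
  unfolding marginal_map_contact
proof (rule maximally_monotoneI_surj[OF monotone_subdifferential[OF proper]])
  fix z
  obtain x where "x \<in> contact_set f" "(\<Sum>j\<in>UNIV. x $ j) = z" using contact_of_sum .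
  then show "\<exists>p. z - p \<in> subdifferential (f i) p" using contact_subgradient by metis
qed

lemma sum_Prox: "(\<Sum>i\<in>UNIV. Prox (f i) z) = z"
proof -
  obtain x where x: "x \<in> contact_set f" "(\<Sum>j\<in>UNIV. x $ j) = z" using contact_of_sum .
  have "Prox (f i) z = x $ i" for i
    using Prox_eqI[OF proper contact_subgradient[OF x(1)]] x(2) by metis
  then show ?thesis using x(2) by simp
qed

lemma sum_moreau_envelope_conjugate:
  "(\<Sum>i\<in>UNIV. moreau_envelope (conjugate (f i)) z) = ereal (half_sq z)"
proof -
  obtain x where x: "x \<in> contact_set f" "(\<Sum>j\<in>UNIV. x $ j) = z" using contact_of_sum .
  obtain r where r: "\<And>i. f i (x $ i) = ereal (r i)" "(\<Sum>i\<in>UNIV. r i) = cost x"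
    using contact_finite[OF x(1)] by blast
  have "moreau_envelope (conjugate (f i)) z = ereal (inner z (x $ i) - half_sq (x $ i) - r i)" for i
    using moreau_envelope_conjugate_eq[OF proper, of z "x $ i" i] contact_subgradient[OF x(1), of i]
    by (cases "moreau_envelope (conjugate (f i)) z") (auto simp: x(2) r(1))
  then have "(\<Sum>i\<in>UNIV. moreau_envelope (conjugate (f i)) z) =
      ereal (inner z (\<Sum>i\<in>UNIV. x $ i) - (\<Sum>i\<in>UNIV. half_sq (x $ i)) - (\<Sum>i\<in>UNIV. r i))"
    by (simp add: sum_subtractf inner_sum_right)
  then show ?thesis by (simp add: r(2) cost_eq_half_sq x(2) half_sq_inner)
qed

lemma contact_plus_diagonal_comp: "contact_set f + diagonal\<^sup>\<bottom> = UNIV"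
proof -
  have "w \<in> contact_set f + diagonal\<^sup>\<bottom>" for w
  proof -
    obtain x where x: "x \<in> contact_set f" "(\<Sum>j\<in>UNIV. x $ j) = (\<Sum>j\<in>UNIV. w $ j)"
      using contact_of_sum .
    have "w - x \<in> diagonal\<^sup>\<bottom>"
      using x(2) by (auto simp: orthogonal_comp_def diagonal_def orthogonal_def inner_vec_def
          inner_sum_right[symmetric] sum_subtractf)
    then show ?thesis using set_plus_intro[OF x(1)] by fastforce
  qed
  then show ?thesis by blast
qed

end

end

section \<open>Conjugate families with an essentially smooth first member\<close>

theorem theorem1p4:
  fixes f :: "'k::{finite,linorder} \<Rightarrow> real ^ 'n \<Rightarrow> ereal"
    and \<Gamma> :: "((real ^ 'n) ^ 'k::{finite,linorder}) set"
  assumes "CARD('k) \<ge> 2"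
    and "\<And>i. f i \<in> proper_lsc_convex"
    and "\<And>x1. f first_index x1 =
           (SUP x\<in>{x. x $ first_index = x1}.
              ereal (cost x) - (\<Sum>i\<in>UNIV - {first_index}. f i (x $ i)))"
    and "essentially_smooth (f first_index)"
    and "\<Gamma> = contact_set f"
  shows "(\<exists>i0. maximally_monotone (marginal_map \<Gamma> i0)) \<and>
         (\<exists>i0. marginal_map \<Gamma> i0 = subdifferential (f i0)) \<and>
         (\<forall>i. marginal_map \<Gamma> i = subdifferential (f i)) \<and>
         (\<forall>x. (\<Sum>i\<in>UNIV. Prox (f i) x) = x) \<and>
         (\<forall>x. (\<Sum>i\<in>UNIV. moreau_envelope (conjugate (f i)) x) = ereal (half_sq x)) \<and>
         \<Gamma> + diagonal\<^sup>\<bottom> = UNIV \<and>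
         sum_set \<Gamma> = UNIV"
proof -
  have proper: "proper_fun (f i)" for i using proper_lsc_convexD(1)[OF assms(2)] .
  have cost_le: "ereal (cost x) \<le> (\<Sum>i\<in>UNIV. f i (x $ i))" for x
  proof -
    let ?R = "\<Sum>i\<in>UNIV - {first_index}. f i (x $ i)"
    have "ereal (cost x) - ?R \<le> f first_index (x $ first_index)"
      unfolding assms(3) by (rule SUP_upper) simp
    moreover have "f i y \<noteq> -\<infinity>" for i y using proper[of i] by (simp add: proper_fun_def)
    moreover have "?R \<noteq> -\<infinity>"
      using calculation(2) by (intro sum_neq_MInfty)
    ultimately have "ereal (cost x) \<le> f first_index (x $ first_index) + ?R"
      by (cases ?R; cases "f first_index (x $ first_index)") auto
    then show ?thesis by (subst sum.remove[of _ first_index]) auto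
  qed
  have onto: "sum_set (contact_set f) = UNIV"
    by (rule essentially_smooth_sum_set_contact[OF proper cost_le assms(2-4)])
  note facts = maximally_monotone_marginal[OF proper cost_le onto]
    marginal_map_contact[OF proper cost_le onto] sum_Prox[OF proper cost_le onto]
    sum_moreau_envelope_conjugate[OF proper cost_le onto]
    contact_plus_diagonal_comp[OF proper cost_le onto]
  show ?thesis
    unfolding assms(5) by (intro conjI allI facts onto exI[of _ first_index])
qed

end
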